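(* Let $\mathcal{R}^{MS}$ be the region of mean-square stability of the randomized two-stage Runge-Kutta method and $\mathcal{R}^{Mid}$ the region of absolute stability of the deterministic midpoint scheme. Then: (i) The sets $\mathcal{R}^{MS}$ and $\mathcal{R}^{Mid}$ are open and symmetric with respect to the real axis. (ii) There exists $r_0\in(0,\infty)$ such that $\mathcal{R}^{MS}\subset\mathcal{R}^{Mid}\subset\mathbb{C}_{-}\cap\{z\in\mathbb{C}:|z|<r_0\}$. (iii) $\mathcal{I}^{MS}=(x_0,0)$ with $x_0=-1-(\sqrt2-1)^{-1/3}+(\sqrt2-1)^{1/3}$, while $\mathcal{I}^{Mid}=(-2,0)$, and $\mathcal{I}^{MS}\subset\mathcal{I}^{Mid}$.
   Context: $\mathbb{C}_{-}=\{z\in\mathbb{C}:\Re(z)<0\}$. Let $(\tau_j)_{j\in\mathbb{N}}$ be i.i.d. random variables uniformly distributed on $[0,1]$ on a complete probability space $(\Omega,\Sigma,\mathbb{P})$. For $z\in\mathbb{C}$ put $p_j(z)=\tau_jz^2+z+1$. Fix $\eta\ne0$. Applying the randomized two-stage Runge-Kutta method with step-size $h>0$ to the test problem $z'(t)=\lambda z(t)$, $t\ge0$, $z(0)=\eta$ ($\lambda\in\mathbb{C}$), and substituting $z=h\lambda$, gives $V^0=\eta$ and $V^k=V^k(z)=\eta\prod_{j=1}^kp_j(z)$, $k\in\mathbb{N}$. Define $\mathcal{R}^{MS}=\{z\in\mathbb{C}: V^k\to0\text{ in }L^2(\Omega)\text{ as }k\to\infty\}$, $\mathcal{R}^{Mid}=\{z\in\mathbb{C}:|\tfrac12z^2+z+1|^2<1\}$,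 $\mathcal{I}^{MS}=\mathcal{R}^{MS}\cap\{z\in\mathbb{C}:\Im(z)=0\}$ and $\mathcal{I}^{Mid}=\mathcal{R}^{Mid}\cap\{z\in\mathbb{C}:\Im(z)=0\}$; the latter two are identified with subsets of $\mathbb{R}$. *)

theory Defs
  imports "HOL-Probability.Probability"
begin

definition in_L2 :: "'a measure \<Rightarrow> ('a \<Rightarrow> complex) \<Rightarrow> bool" where
  "in_L2 M f \<longleftrightarrow> f \<in> borel_measurable M \<and> integrable M (\<lambda>\<omega>. (norm (f \<omega>))\<^sup>2)"

definition L2_norm :: "'a measure \<Rightarrow> ('a \<Rightarrow> complex) \<Rightarrow> real" where
  "L2_norm M f = sqrt (LINT \<omega>|M. (norm (f \<omega>))\<^sup>2)"

text \<open>Square integrability is required explicitly, since the Bochner integral of a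
  non-integrable function is \<open>0\<close> by convention.\<close>
definition tendsto_L2 :: "'a measure \<Rightarrow> (nat \<Rightarrow> 'a \<Rightarrow> complex) \<Rightarrow> ('a \<Rightarrow> complex) \<Rightarrow> bool" where
  "tendsto_L2 M X Y \<longleftrightarrow>
     (\<forall>k. in_L2 M (X k)) \<and> in_L2 M Y \<and> (\<lambda>k. L2_norm M (\<lambda>\<omega>. X k \<omega> - Y \<omega>)) \<longlonglongrightarrow> 0"

definition rk_factor :: "(nat \<Rightarrow> 'a \<Rightarrow> real) \<Rightarrow> nat \<Rightarrow> complex \<Rightarrow> 'a \<Rightarrow> complex" where
  "rk_factor \<tau> j z \<omega> = of_real (\<tau> j \<omega>) * z\<^sup>2 + z + 1"

text \<open>The iterates of the randomized two-stage Runge-Kutta scheme with step size \<open>h\<close> for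
  the test equation \<open>u' = \<lambda> u\<close>, \<open>u 0 = \<eta>\<close>, written in terms of \<open>z = h \<lambda>\<close>.\<close>
definition rk_iterate ::
  "(nat \<Rightarrow> 'a \<Rightarrow> real) \<Rightarrow> complex \<Rightarrow> complex \<Rightarrow> nat \<Rightarrow> 'a \<Rightarrow> complex" where
  "rk_iterate \<tau> \<eta> z k \<omega> = \<eta> * (\<Prod>j=1..k. rk_factor \<tau> j z \<omega>)"

definition R_MS :: "'a measure \<Rightarrow> (nat \<Rightarrow> 'a \<Rightarrow> real) \<Rightarrow> complex \<Rightarrow> complex set" where
  "R_MS M \<tau> \<eta> = {z. tendsto_L2 M (rk_iterate \<tau> \<eta> z) (\<lambda>\<omega>. 0)}"

definition R_Mid :: "complex set" where
  "R_Mid = {z. (norm (1 / 2 * z\<^sup>2 + z + 1))\<^sup>2 < 1}"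

definition I_MS :: "'a measure \<Rightarrow> (nat \<Rightarrow> 'a \<Rightarrow> real) \<Rightarrow> complex \<Rightarrow> complex set" where
  "I_MS M \<tau> \<eta> = R_MS M \<tau> \<eta> \<inter> {z. Im z = 0}"

definition I_Mid :: "complex set" where
  "I_Mid = R_Mid \<inter> {z. Im z = 0}"

definition left_half_plane :: "complex set" where
  "left_half_plane = {z. Re z < 0}"

end

theory Submission
  imports Defs
begin

text \<open>
  The factors \<open>p\<^sub>j(z) = \<tau>\<^sub>j z\<^sup>2 + z + 1\<close> are independent and identically distributed, so
  \<open>E |V\<^sup>k|\<^sup>2 = |\<eta>|\<^sup>2 m(z)\<^sup>k\<close> with \<open>m(z) = E |p\<^sub>1(z)|\<^sup>2\<close>, and mean-square stability says exactly that
  \<open>m(z) < 1\<close>. Splitting \<open>\<tau>\<^sub>1\<close> into its mean \<open>1/2\<close> and a centred part of variance \<open>1/12\<close> gives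
  the bias-variance decomposition
  \<open>m(z) = |z\<^sup>2/2 + z + 1|\<^sup>2 + |z|\<^sup>4/12\<close>,
  whose first term is the midpoint stability function. Hence \<open>m\<close> is continuous and invariant under
  conjugation, and \<open>R_MS\<close> lies inside \<open>R_Mid\<close>.

  The geometry of \<open>R_Mid\<close> becomes visible after the shift \<open>w = z + 1\<close>: since
  \<open>z\<^sup>2/2 + z + 1 = (w\<^sup>2 + 1)/2\<close>, the region is the inside of the Cassini oval
  \<open>|w\<^sup>2 + 1| < 2\<close> with foci \<open>\<plusminus>\<i>\<close>, which touches the line \<open>Re w = 1\<close> only at \<open>w = 1\<close>, and on
  which \<open>|w|\<^sup>2 < 3\<close>.

  On the real axis \<open>m(x) - 1 = x (x\<^sup>3 + 3x\<^sup>2 + 6x + 6) / 3\<close>. The same shift turns the cubic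
  into \<open>y\<^sup>3 + 3y + 2\<close> with \<open>y = x + 1\<close>; it is strictly increasing, and Cardano's substitution
  \<open>y = a - 1/a\<close> with \<open>a\<^sup>3 = \<surd>2 - 1\<close> yields its only real root \<open>x0 + 1\<close>. Because \<open>x0\<close> lies in
  \<open>(-2, 0)\<close>, the point \<open>x0\<close> is in \<open>R_Mid\<close> but not in \<open>R_MS\<close>, which makes both the inclusion of
  the regions and that of the intervals strict.
\<close>

section \<open>The second moment of the iterates\<close>

text \<open>This is the closed form of \<open>E |\<tau> z\<^sup>2 + z + 1|\<^sup>2\<close> for \<open>\<tau>\<close> uniform on \<open>[0,1]\<close>, the factor by
  which one step multiplies the second moment.\<close>

definition mean_square_growth :: "complex \<Rightarrow> real" where
  "mean_square_growth z = (norm (1 / 2 * z\<^sup>2 + z + 1))\<^sup>2 + norm z ^ 4 / 12"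

lemma mean_square_growth_nonneg: "0 \<le> mean_square_growth z"
  by (simp add: mean_square_growth_def)

text \<open>Centring \<open>X\<close> at its mean \<open>\<mu>\<close> makes the cross term between \<open>\<mu> a + c\<close> and \<open>(X - \<mu>) a\<close>
  vanish in expectation.\<close>

lemma (in prob_space) second_moment_affine:
  fixes X :: "'a \<Rightarrow> real" and a c :: complex
  assumes [simp]: "integrable M X" "integrable M (\<lambda>\<omega>. (X \<omega>)\<^sup>2)"
  shows "integrable M (\<lambda>\<omega>. (norm (of_real (X \<omega>) * a + c))\<^sup>2)"
    and "expectation (\<lambda>\<omega>. (norm (of_real (X \<omega>) * a + c))\<^sup>2)
      = (norm (of_real (expectation X) * a + c))\<^sup>2 + variance X * (norm a)\<^sup>2"
proof -
  define \<mu> where "\<mu> = expectation X"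
  define b where "b = of_real \<mu> * a + c"
  have expand: "(norm (of_real (X \<omega>) * a + c))\<^sup>2
      = (norm b)\<^sup>2 + (X \<omega> - \<mu>) * (2 * Re (b * cnj a)) + (X \<omega> - \<mu>)\<^sup>2 * (norm a)\<^sup>2" for \<omega>
    unfolding b_def cmod_power2 by (simp add: algebra_simps power2_eq_square)
  have sq: "integrable M (\<lambda>\<omega>. (X \<omega> - \<mu>)\<^sup>2)"
    by (simp add: power2_diff)
  have centred: "integrable M (\<lambda>\<omega>. X \<omega> - \<mu>)" "expectation (\<lambda>\<omega>. X \<omega> - \<mu>) = 0"
    by (simp_all add: \<mu>_def prob_space)
  show "integrable M (\<lambda>\<omega>. (norm (of_real (X \<omega>) * a + c))\<^sup>2)"
    unfolding expand using sq centred(1) by auto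
  show "expectation (\<lambda>\<omega>. (norm (of_real (X \<omega>) * a + c))\<^sup>2)
      = (norm (of_real (expectation X) * a + c))\<^sup>2 + variance X * (norm a)\<^sup>2"
    unfolding expand using sq centred
    by (simp add: prob_space b_def[symmetric] \<mu>_def[symmetric])
qed

lemma (in prob_space) second_moment_rk_factor:
  assumes D: "distributed M lborel (\<tau> j) (\<lambda>x. indicator {0..1} x / measure lborel {0..1::real})"
  shows "integrable M (\<lambda>\<omega>. (norm (rk_factor \<tau> j z \<omega>))\<^sup>2)"
    and "expectation (\<lambda>\<omega>. (norm (rk_factor \<tau> j z \<omega>))\<^sup>2) = mean_square_growth z"
proof -
  have [measurable]: "\<tau> j \<in> borel_measurable M"
    using distributed_measurable[OF D] by simp
  have bounds: "AE \<omega> in M. \<tau> j \<omega> \<in> {0..1}"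
    by (subst distributed_AE2[OF D]) (auto split: split_indicator)
  have "integrable M (\<tau> j)"
    by (rule integrable_const_bound[where B = 1]) (use bounds in auto)
  moreover have "integrable M (\<lambda>\<omega>. (\<tau> j \<omega>)\<^sup>2)"
    by (rule integrable_const_bound[where B = 1]) (use bounds in \<open>auto simp: power_le_one\<close>)
  ultimately have moments:
    "integrable M (\<lambda>\<omega>. (norm (of_real (\<tau> j \<omega>) * z\<^sup>2 + (z + 1)))\<^sup>2)"
    "expectation (\<lambda>\<omega>. (norm (of_real (\<tau> j \<omega>) * z\<^sup>2 + (z + 1)))\<^sup>2)
      = (norm (of_real (expectation (\<tau> j)) * z\<^sup>2 + (z + 1)))\<^sup>2 + variance (\<tau> j) * (norm (z\<^sup>2))\<^sup>2"
    by (rule second_moment_affine)+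
  show "integrable M (\<lambda>\<omega>. (norm (rk_factor \<tau> j z \<omega>))\<^sup>2)"
    using moments(1) by (simp add: rk_factor_def add.assoc)
  show "expectation (\<lambda>\<omega>. (norm (rk_factor \<tau> j z \<omega>))\<^sup>2) = mean_square_growth z"
    using moments(2)
    unfolding uniform_distributed_variance[OF D]
    unfolding uniform_distributed_expectation[OF D]
    by (simp add: rk_factor_def mean_square_growth_def add.assoc norm_power flip: power_mult)
qed

lemma (in prob_space) second_moment_rk_iterate:
  assumes indep: "indep_vars (\<lambda>_. borel) \<tau> {1..}"
    and D: "\<And>j. j \<ge> 1 \<Longrightarrow>
      distributed M lborel (\<tau> j) (\<lambda>x. indicator {0..1} x / measure lborel {0..1::real})"
  shows "in_L2 M (rk_iterate \<tau> \<eta> z k)"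
    and "expectation (\<lambda>\<omega>. (norm (rk_iterate \<tau> \<eta> z k \<omega>))\<^sup>2)
      = (norm \<eta>)\<^sup>2 * mean_square_growth z ^ k"
proof -
  have norm_sq: "(norm (rk_iterate \<tau> \<eta> z k \<omega>))\<^sup>2
      = (norm \<eta>)\<^sup>2 * (\<Prod>j=1..k. (norm (rk_factor \<tau> j z \<omega>))\<^sup>2)" for \<omega>
    by (simp add: rk_iterate_def norm_mult power_mult_distrib prod_power_distrib flip: prod_norm)
  have "indep_vars (\<lambda>_. borel) \<tau> {1..k}"
    by (rule indep_vars_subset[OF indep]) auto
  then have indep_sq: "indep_vars (\<lambda>_. borel) (\<lambda>j \<omega>. (norm (rk_factor \<tau> j z \<omega>))\<^sup>2) {1..k}"
    unfolding rk_factor_def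
    by (rule indep_vars_compose2[where Y = "\<lambda>j t. (norm (of_real t * z\<^sup>2 + z + 1))\<^sup>2"]) measurable
  have fin: "finite {1..k}" by simp
  have int: "integrable M (\<lambda>\<omega>. (norm (rk_factor \<tau> j z \<omega>))\<^sup>2)" if "j \<in> {1..k}" for j
    using second_moment_rk_factor(1)[OF D] that by auto
  have "rk_factor \<tau> j z \<in> borel_measurable M" if "j \<in> {1..k}" for j
  proof -
    have [measurable]: "\<tau> j \<in> borel_measurable M"
      using distributed_measurable[OF D[of j]] that by simp
    show ?thesis unfolding rk_factor_def by measurable
  qed
  then have "rk_iterate \<tau> \<eta> z k \<in> borel_measurable M"
    unfolding rk_iterate_def by (intro borel_measurable_times borel_measurable_prod) auto
  then show "in_L2 M (rk_iterate \<tau> \<eta> z k)"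
    using indep_vars_integrable[OF fin indep_sq int] by (simp add: in_L2_def norm_sq)
  show "expectation (\<lambda>\<omega>. (norm (rk_iterate \<tau> \<eta> z k \<omega>))\<^sup>2) = (norm \<eta>)\<^sup>2 * mean_square_growth z ^ k"
    using indep_vars_lebesgue_integral[OF fin indep_sq int] second_moment_rk_factor(2)[OF D]
    by (simp add: norm_sq)
qed

text \<open>The \<open>L\<^sup>2\<close> norm of \<open>V\<^sup>k\<close> is a geometric sequence with ratio \<open>\<surd>m(z)\<close>, and it starts at
  \<open>|\<eta>| > 0\<close>, so it tends to \<open>0\<close> only if the ratio is below \<open>1\<close>.\<close>

lemma (in prob_space) R_MS_eq:
  assumes indep: "indep_vars (\<lambda>_. borel) \<tau> {1..}"
    and D: "\<And>j. j \<ge> 1 \<Longrightarrow>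
      distributed M lborel (\<tau> j) (\<lambda>x. indicator {0..1} x / measure lborel {0..1::real})"
    and "\<eta> \<noteq> 0"
  shows "R_MS M \<tau> \<eta> = {z. mean_square_growth z < 1}"
proof -
  have "z \<in> R_MS M \<tau> \<eta> \<longleftrightarrow> mean_square_growth z < 1" for z
  proof -
    define q where "q = sqrt (mean_square_growth z)"
    have "L2_norm M (\<lambda>\<omega>. rk_iterate \<tau> \<eta> z k \<omega> - 0) = norm \<eta> * q ^ k" for k
      by (simp add: L2_norm_def second_moment_rk_iterate(2)[OF indep D] q_def
          real_sqrt_mult real_sqrt_power)
    then have "z \<in> R_MS M \<tau> \<eta> \<longleftrightarrow> (\<lambda>k. norm \<eta> * q ^ k) \<longlonglongrightarrow> 0"
      using second_moment_rk_iterate(1)[OF indep D]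
      by (simp add: R_MS_def tendsto_L2_def in_L2_def)
    also have "\<dots> \<longleftrightarrow> (\<lambda>k. q ^ k) \<longlonglongrightarrow> 0"
      using tendsto_mult_left_iff[of "norm \<eta>" "\<lambda>k. q ^ k" 0] \<open>\<eta> \<noteq> 0\<close> by simp
    also have "\<dots> \<longleftrightarrow> q < 1"
    proof
      assume "(\<lambda>k. q ^ k) \<longlonglongrightarrow> 0"
      then obtain k where "q ^ k < 1"
        using order_tendstoD(2)[of "\<lambda>k. q ^ k" 0 sequentially 1] eventually_happens by force
      then show "q < 1" using one_le_power[of q k] by linarith
    next
      assume "q < 1"
      then show "(\<lambda>k. q ^ k) \<longlonglongrightarrow> 0"
        using mean_square_growth_nonneg[of z] by (intro LIMSEQ_power_zero) (simp add: q_def)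
    qed
    finally show ?thesis by (simp add: q_def)
  qed
  then show ?thesis by auto
qed

section \<open>The stability regions in the complex plane\<close>

lemma mean_square_growth_cnj: "mean_square_growth (cnj z) = mean_square_growth z"
proof -
  have "1 / 2 * (cnj z)\<^sup>2 + cnj z + 1 = cnj (1 / 2 * z\<^sup>2 + z + 1)" by simp
  then show ?thesis unfolding mean_square_growth_def by (metis complex_mod_cnj)
qed

lemma cnj_mem_R_Mid_iff: "cnj z \<in> R_Mid \<longleftrightarrow> z \<in> R_Mid"
proof -
  have "1 / 2 * (cnj z)\<^sup>2 + cnj z + 1 = cnj (1 / 2 * z\<^sup>2 + z + 1)" by simp
  then show ?thesis unfolding R_Mid_def mem_Collect_eq by (metis complex_mod_cnj)
qed

lemma cnj_image_eq_self:
  assumes "\<And>z. cnj z \<in> A \<longleftrightarrow> z \<in> A"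
  shows "cnj ` A = A"
  using assms by (auto intro!: image_eqI[of _ cnj "cnj _"])

text \<open>Completing the square removes the linear term. This centred form gives the half-plane, the
  norm bound and the real interval.\<close>

lemma R_Mid_cassini: "z \<in> R_Mid \<longleftrightarrow> (norm ((z + 1)\<^sup>2 + 1))\<^sup>2 < 4"
proof -
  have "1 / 2 * z\<^sup>2 + z + 1 = ((z + 1)\<^sup>2 + 1) / 2"
    by (simp add: power2_eq_square field_simps)
  then have "norm (1 / 2 * z\<^sup>2 + z + 1) = norm ((z + 1)\<^sup>2 + 1) / 2"
    by (simp only: norm_divide) simp
  then show ?thesis unfolding R_Mid_def mem_Collect_eq by (simp only: power_divide) simp
qed

text \<open>On \<open>Re w \<ge> 1\<close> the term \<open>2 a\<^sup>2 b\<^sup>2\<close> absorbs the only negative term \<open>- 2 b\<^sup>2\<close> of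
  \<open>|w\<^sup>2 + 1|\<^sup>2\<close>, where \<open>w = a + b \<i>\<close>, and the rest is at least \<open>4\<close>.\<close>

lemma R_Mid_subset_left_half_plane: "R_Mid \<subseteq> left_half_plane"
proof
  fix z assume z: "z \<in> R_Mid"
  define a b where "a = Re z + 1" and "b = Im z"
  have oval: "(norm ((z + 1)\<^sup>2 + 1))\<^sup>2 = (a\<^sup>2)\<^sup>2 + 2 * a\<^sup>2 * b\<^sup>2 + (b\<^sup>2)\<^sup>2 + 2 * a\<^sup>2 - 2 * b\<^sup>2 + 1"
    unfolding cmod_power2 a_def b_def by (simp add: algebra_simps power2_eq_square)
  have "a < 1"
  proof (rule ccontr)
    assume "\<not> a < 1"
    then have a: "1 \<le> a\<^sup>2" by simp
    then have "b\<^sup>2 \<le> a\<^sup>2 * b\<^sup>2" by (simp add: mult_le_cancel_right1)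
    moreover have "1 \<le> (a\<^sup>2)\<^sup>2" using a by (rule one_le_power)
    moreover have "0 \<le> (b\<^sup>2)\<^sup>2" by simp
    ultimately show False using z a unfolding R_Mid_cassini oval by linarith
  qed
  then show "z \<in> left_half_plane" by (simp add: left_half_plane_def a_def)
qed

lemma R_Mid_norm_less:
  assumes "z \<in> R_Mid"
  shows "norm z < 3"
proof -
  have "norm ((z + 1)\<^sup>2 + 1) < 2"
    using assms power_less_imp_less_base[of "norm ((z + 1)\<^sup>2 + 1)" 2 2] by (simp add: R_Mid_cassini)
  then have "(norm (z + 1))\<^sup>2 < 3"
    using norm_diff_ineq[of "(z + 1)\<^sup>2" 1] by (simp add: norm_power)
  then have "norm (z + 1) < 2"
    using power_less_imp_less_base[of "norm (z + 1)" 2 2] by simp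
  then show ?thesis
    using norm_diff_ineq[of z 1] by simp
qed

section \<open>The stability intervals on the real axis\<close>

lemma of_real_mem_R_Mid_iff: "complex_of_real x \<in> R_Mid \<longleftrightarrow> -2 < x \<and> x < 0"
proof -
  have "norm ((complex_of_real x + 1)\<^sup>2 + 1) = (x + 1)\<^sup>2 + 1"
  proof -
    have "(complex_of_real x + 1)\<^sup>2 + 1 = of_real ((x + 1)\<^sup>2 + 1)" by simp
    then show ?thesis by (simp only: norm_of_real) simp
  qed
  then have "complex_of_real x \<in> R_Mid \<longleftrightarrow> ((x + 1)\<^sup>2 + 1)\<^sup>2 < 2\<^sup>2"
    by (simp add: R_Mid_cassini)
  also have "\<dots> \<longleftrightarrow> (x + 1)\<^sup>2 + 1 < 2"
    using power_mono_iff[of 2 "(x + 1)\<^sup>2 + 1" 2] by (simp add: not_le[symmetric])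
  also have "\<dots> \<longleftrightarrow> \<bar>x + 1\<bar> < 1"
    using abs_square_less_1[of "x + 1"] by simp
  also have "\<dots> \<longleftrightarrow> -2 < x \<and> x < 0" by auto
  finally show ?thesis .
qed

lemma mean_square_growth_of_real:
  "mean_square_growth (complex_of_real x) = 1 + x * ((x + 1) ^ 3 + 3 * (x + 1) + 2) / 3"
proof -
  have "1 / 2 * (complex_of_real x)\<^sup>2 + complex_of_real x + 1 = of_real (x\<^sup>2 / 2 + x + 1)"
    by simp
  then have "mean_square_growth (complex_of_real x) = (x\<^sup>2 / 2 + x + 1)\<^sup>2 + x ^ 4 / 12"
    unfolding mean_square_growth_def by (simp only: norm_of_real) simp
  also have "\<dots> = 1 + x * ((x + 1) ^ 3 + 3 * (x + 1) + 2) / 3"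
    by (simp add: field_simps power2_eq_square power3_eq_cube power4_eq_xxxx)
  finally show ?thesis .
qed

lemma cubic_strict_mono: "strict_mono (\<lambda>y :: real. y ^ 3 + 3 * y + 2)"
proof (rule strict_monoI)
  fix x y :: real assume "x < y"
  moreover from this have "x ^ 3 \<le> y ^ 3" by (intro power_mono_odd) auto
  ultimately show "x ^ 3 + 3 * x + 2 < y ^ 3 + 3 * y + 2" by simp
qed

text \<open>Cardano's formula: for \<open>y = a - 1/a\<close> one has \<open>y\<^sup>3 + 3y = a\<^sup>3 - 1/a\<^sup>3\<close>, which is
  \<open>(\<surd>2 - 1) - (\<surd>2 + 1) = -2\<close>.\<close>

lemma cardano_root:
  fixes y :: real
  assumes "y = (sqrt 2 - 1) powr (1 / 3) - (sqrt 2 - 1) powr (- 1 / 3)"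
  shows "y ^ 3 + 3 * y + 2 = 0"
proof -
  define a where "a = (sqrt 2 - 1) powr (1 / 3)"
  have pos: "0 < sqrt 2 - 1" by simp
  have a: "0 < a" using pos by (simp add: a_def)
  have "a ^ 3 = (sqrt 2 - 1) powr (1 / 3 * real 3)"
    unfolding a_def using pos by (simp add: powr_power)
  then have a3: "a ^ 3 = sqrt 2 - 1" using pos by simp
  have y: "y = a - inverse a"
    unfolding assms a_def by (simp add: powr_minus flip: minus_divide_left)
  have "y ^ 3 + 3 * y = a ^ 3 - inverse (a ^ 3)"
    unfolding y using a by (simp add: field_simps power3_eq_cube)
  also have "inverse (a ^ 3) = sqrt 2 + 1"
    unfolding a3 using pos by (intro inverse_unique) (simp add: algebra_simps)
  finally show ?thesis using a3 by simp
qed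

lemma real_axis_Int_eq:
  assumes "\<And>x. complex_of_real x \<in> A \<longleftrightarrow> P x"
  shows "A \<inter> {z. Im z = 0} = complex_of_real ` {x. P x}"
proof (intro equalityI subsetI)
  fix z assume z: "z \<in> A \<inter> {z. Im z = 0}"
  then have "z = of_real (Re z)" by (simp add: complex_eq_iff)
  with z assms[of "Re z"] show "z \<in> complex_of_real ` {x. P x}" by force
qed (use assms in auto)

section \<open>Comparison of the two regions\<close>

theorem theorem3:
  fixes M :: "'a measure" and \<tau> :: "nat \<Rightarrow> 'a \<Rightarrow> real" and \<eta> :: complex and x0 :: real
  assumes "prob_space M" and "complete_measure M"
    and "prob_space.indep_vars M (\<lambda>_. borel) \<tau> {1..}"
    and "\<And>j. j \<ge> 1 \<Longrightarrow> distributed M lborel (\<tau> j) (\<lambda>x. indicator {0..1} x / measure lborel {0..1::real})"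
    and "\<eta> \<noteq> 0"
    and "x0 = - 1 - (sqrt 2 - 1) powr (- 1 / 3) + (sqrt 2 - 1) powr (1 / 3)"
  shows "(open (R_MS M \<tau> \<eta>) \<and> open R_Mid \<and> cnj ` R_MS M \<tau> \<eta> = R_MS M \<tau> \<eta> \<and> cnj ` R_Mid = R_Mid)
    \<and> (\<exists>r0>0. R_MS M \<tau> \<eta> \<subset> R_Mid \<and> R_Mid \<subset> left_half_plane \<inter> {z. norm z < r0})
    \<and> (I_MS M \<tau> \<eta> = complex_of_real ` {x0<..<0} \<and> I_Mid = complex_of_real ` {-2<..<0}
       \<and> I_MS M \<tau> \<eta> \<subset> I_Mid)"
proof -
  interpret prob_space M by fact
  have MS: "R_MS M \<tau> \<eta> = {z. mean_square_growth z < 1}"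
    using assms(3-5) by (rule R_MS_eq)

  have "open (R_MS M \<tau> \<eta>)"
    unfolding MS mean_square_growth_def by (intro open_Collect_less continuous_intros) simp
  moreover have "open R_Mid"
    unfolding R_Mid_def by (intro open_Collect_less continuous_intros)
  moreover have "cnj ` R_MS M \<tau> \<eta> = R_MS M \<tau> \<eta>"
    by (rule cnj_image_eq_self) (simp add: MS mean_square_growth_cnj)
  moreover have "cnj ` R_Mid = R_Mid"
    by (rule cnj_image_eq_self) (rule cnj_mem_R_Mid_iff)
  ultimately have part_i:
    "open (R_MS M \<tau> \<eta>) \<and> open R_Mid \<and> cnj ` R_MS M \<tau> \<eta> = R_MS M \<tau> \<eta> \<and> cnj ` R_Mid = R_Mid"
    by blast

  define cubic where "cubic y = y ^ 3 + 3 * y + 2" for y :: real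
  have mono: "cubic u < cubic v \<longleftrightarrow> u < v" for u v
    using strict_mono_less[OF cubic_strict_mono] by (simp add: cubic_def)
  have root: "cubic (x0 + 1) = 0"
    unfolding cubic_def by (rule cardano_root) (simp add: assms(6))
  \<comment> \<open>The signs \<open>cubic (-1) = -2\<close> and \<open>cubic 1 = 6\<close> put the root \<open>x0 + 1\<close> between \<open>-1\<close> and \<open>1\<close>.\<close>
  have x0: "-2 < x0" "x0 < 0"
    using mono[of "-1" "x0 + 1"] mono[of "x0 + 1" 1] by (simp_all add: root) (simp_all add: cubic_def)
  have cubic_pos: "0 < cubic (x + 1) \<longleftrightarrow> x0 < x" for x
    using mono[of "x0 + 1" "x + 1"] root by simp
  have cubic_neg: "cubic (x + 1) < 0 \<longleftrightarrow> x < x0" for x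
    using mono[of "x + 1" "x0 + 1"] root by simp
  have real_MS: "complex_of_real x \<in> R_MS M \<tau> \<eta> \<longleftrightarrow> x0 < x \<and> x < 0" for x
  proof -
    have "complex_of_real x \<in> R_MS M \<tau> \<eta> \<longleftrightarrow> x * cubic (x + 1) < 0"
      by (simp add: MS mean_square_growth_of_real cubic_def)
    also have "\<dots> \<longleftrightarrow> x0 < x \<and> x < 0"
      using x0 by (auto simp: mult_less_0_iff cubic_pos cubic_neg)
    finally show ?thesis .
  qed
  have I_MS: "I_MS M \<tau> \<eta> = complex_of_real ` {x0<..<0}"
    unfolding I_MS_def by (subst real_axis_Int_eq[OF real_MS]) (auto simp: greaterThanLessThan_eq)
  have I_Mid: "I_Mid = complex_of_real ` {-2<..<0}"
    unfolding I_Mid_def by (subst real_axis_Int_eq[OF of_real_mem_R_Mid_iff]) auto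

  have "R_MS M \<tau> \<eta> \<subseteq> R_Mid"
  proof
    fix z assume "z \<in> R_MS M \<tau> \<eta>"
    moreover have "0 \<le> norm z ^ 4 / 12" by simp
    ultimately show "z \<in> R_Mid"
      unfolding MS R_Mid_def mem_Collect_eq mean_square_growth_def by linarith
  qed
  moreover have x0_separates: "complex_of_real x0 \<in> R_Mid" "complex_of_real x0 \<notin> R_MS M \<tau> \<eta>"
    using x0 by (simp_all add: of_real_mem_R_Mid_iff real_MS)
  ultimately have MS_Mid: "R_MS M \<tau> \<eta> \<subset> R_Mid" by blast
  have I_MS_Mid: "I_MS M \<tau> \<eta> \<subset> I_Mid"
    using MS_Mid x0_separates unfolding I_MS_def I_Mid_def by auto

  have "R_Mid \<subseteq> left_half_plane \<inter> {z. norm z < 3}"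
    using R_Mid_subset_left_half_plane R_Mid_norm_less by auto
  moreover have "complex_of_real (-2) \<in> left_half_plane \<inter> {z. norm z < 3}"
    by (simp add: left_half_plane_def)
  moreover have "complex_of_real (-2) \<notin> R_Mid"
    unfolding of_real_mem_R_Mid_iff by simp
  ultimately have Mid_half_disc: "R_Mid \<subset> left_half_plane \<inter> {z. norm z < 3}" by blast
  have "\<exists>r0>0. R_MS M \<tau> \<eta> \<subset> R_Mid \<and> R_Mid \<subset> left_half_plane \<inter> {z. norm z < r0}"
    using MS_Mid Mid_half_disc by (intro exI[of _ 3]) simp
  with part_i I_MS I_Mid I_MS_Mid show ?thesis by blast
qed

end
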